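(* For $a>0$, $b>0$ consider the planar differential system $$\dot x=(a-x)(1+x^2)-4xy,\qquad \dot y=b x\,(1+x^2-y),\qquad (x,y)\in\mathbb{R}^2,$$ whose unique equilibrium point is $P_a=\left(\tfrac a5,\,1+\tfrac{a^2}{25}\right)$. Define $$B=\left\{(a,b): 0<a\le 5\sqrt{\tfrac53},\ b>0\right\}\cup\left\{(a,b): a>5\sqrt{\tfrac53},\ b>\frac{3a^2-125}{5a}\right\},$$ $$A=\left\{(a,b): 0<a\le 3\sqrt3,\ b>0\right\}\cup\left\{(a,b): a>3\sqrt3,\ b>a-3a^{1/3}\right\}.$$ If $(a,b)\in B$, then the equilibrium point $P_a$ is (locally) asymptotically stable. For each $(a,b)\in A$, the basin of attraction of $P_a$ contains the half-plane $\{(x,y)\in\mathbb{R}^2: x>0\}$.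
   Context: The basin of attraction of $P_a$ is the set of initial conditions whose forward solution is defined for all $t\ge 0$ and converges to $P_a$ as $t\to\infty$. *)

theory Defs
  imports "HOL-Analysis.Analysis"
begin

text \<open>
  Solutions of an autonomous system \<open>x' = f(x)\<close>. At \<open>t = 0\<close> the derivative is one-sided, and
  the values of \<open>\<phi>\<close> at negative times are irrelevant.
\<close>

definition forward_solution ::
  "('v::real_normed_vector \<Rightarrow> 'v) \<Rightarrow> 'v \<Rightarrow> (real \<Rightarrow> 'v) \<Rightarrow> bool" where
  "forward_solution f p \<phi> \<longleftrightarrow>
     \<phi> 0 = p \<and> (\<forall>t\<ge>0. (\<phi> has_vector_derivative f (\<phi> t)) (at t within {0..}))"

text \<open>
  A locally Lipschitz field has a unique forward solution through each point. The definitions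
  below do not presuppose this: they ask that a solution on all of \<open>[0,\<infinity>)\<close> exists and
  that every such solution has the required property.
\<close>

definition basin_of_attraction ::
  "('v::real_normed_vector \<Rightarrow> 'v) \<Rightarrow> 'v \<Rightarrow> 'v set" where
  "basin_of_attraction f P =
     {p. (\<exists>\<phi>. forward_solution f p \<phi>) \<and>
         (\<forall>\<phi>. forward_solution f p \<phi> \<longrightarrow> (\<phi> \<longlongrightarrow> P) at_top)}"

definition lyapunov_stable ::
  "('v::real_normed_vector \<Rightarrow> 'v) \<Rightarrow> 'v \<Rightarrow> bool" where
  "lyapunov_stable f P \<longleftrightarrow>
     (\<forall>\<epsilon>>0. \<exists>\<delta>>0. \<forall>p\<in>ball P \<delta>.
        (\<exists>\<phi>. forward_solution f p \<phi>) \<and>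
        (\<forall>\<phi>. forward_solution f p \<phi> \<longrightarrow> (\<forall>t\<ge>0. \<phi> t \<in> ball P \<epsilon>)))"

definition asymptotically_stable ::
  "('v::real_normed_vector \<Rightarrow> 'v) \<Rightarrow> 'v \<Rightarrow> bool" where
  "asymptotically_stable f P \<longleftrightarrow>
     f P = 0 \<and> lyapunov_stable f P \<and> (\<exists>\<delta>>0. ball P \<delta> \<subseteq> basin_of_attraction f P)"

definition planar_field :: "real \<Rightarrow> real \<Rightarrow> real \<times> real \<Rightarrow> real \<times> real" where
  "planar_field a b = (\<lambda>(x, y). ((a - x) * (1 + x\<^sup>2) - 4 * x * y, b * x * (1 + x\<^sup>2 - y)))"

definition equilibrium_point :: "real \<Rightarrow> real \<times> real" where
  "equilibrium_point a = (a / 5, 1 + a\<^sup>2 / 25)"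

definition region_B :: "(real \<times> real) set" where
  "region_B =
     {(a, b). 0 < a \<and> a \<le> 5 * sqrt (5 / 3) \<and> b > 0} \<union>
     {(a, b). a > 5 * sqrt (5 / 3) \<and> b > (3 * a\<^sup>2 - 125) / (5 * a)}"

definition region_A :: "(real \<times> real) set" where
  "region_A =
     {(a, b). 0 < a \<and> a \<le> 3 * sqrt 3 \<and> b > 0} \<union>
     {(a, b). a > 3 * sqrt 3 \<and> b > a - 3 * a powr (1 / 3)}"

end

theory Submission
  imports Defs "HOL-Real_Asymp.Real_Asymp"
begin

text \<open>
  On \<open>x > 0\<close> write the field as \<open>x' = x w\<close> with \<open>w = g(x) - 4 y\<close>, where
  \<open>g(x) = a/x + a x - 1 - x\<^sup>2\<close>. Then \<open>w' = - x (f(x) w + b k(x))\<close> with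
  \<open>f = b - g'\<close> and \<open>k(x) = (5 x - a) (1 + x\<^sup>2) / x\<close>: after division by \<open>x\<close> this is a Lienard
  equation. Its energy \<open>w\<^sup>2 / 2 + b \<integral> k\<close> is proper on the half-plane, has its strict
  minimum at the equilibrium, and has derivative \<open>- x f(x) w\<^sup>2\<close>. Membership in \<open>region_B\<close> gives
  \<open>f > 0\<close> at the equilibrium, hence on a small sublevel set, and membership in \<open>region_A\<close> gives
  \<open>f > 0\<close> for all \<open>x > 0\<close>, since the minimum of \<open>a/x\<^sup>2 + 2 x\<close> is \<open>3 a\<^sup>1\<^sup>/\<^sup>3\<close>. A small
  multiple of \<open>w k\<close> added to the energy makes the decrease strict on a given sublevel set.
\<close>

section \<open>Existence of solutions\<close>

text \<open>The fundamental theorem on \<open>{0..t+1}\<close> suffices: \<open>t\<close> is not the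
  right endpoint there, so this interval and the half-line define the same filter at
  \<open>t\<close>.\<close>

lemma integral_has_vector_derivative_half_line:
  fixes h :: "real \<Rightarrow> 'v::banach"
  assumes "continuous_on {0..} h" and "t \<ge> 0"
  shows "((\<lambda>u. integral {0..u} h) has_vector_derivative h t) (at t within {0..})"
proof -
  have "((\<lambda>u. integral {0..u} h) has_vector_derivative h t) (at t within {0..t+1})"
    using assms by (intro integral_has_vector_derivative) (auto intro: continuous_on_subset)
  moreover have "at t within {0..t+1} = at t within {0..}"
    by (rule at_within_nhd[of _ "{..<t+1}"]) auto
  ultimately show ?thesis by simp
qed

text \<open>
  With the weight \<open>exp (- 2 (L + 1) t)\<close> the Picard operator contracts on all of \<open>[0,\<infinity>)\<close> at once,
  so no gluing of local solutions is needed.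
\<close>

lemma forward_solution_exists_lipschitz:
  fixes F :: "'v::euclidean_space \<Rightarrow> 'v"
  assumes lip: "L-lipschitz_on UNIV F" and bdd: "bounded (range F)"
  shows "\<exists>\<phi>. forward_solution F p \<phi>"
proof -
  \<comment> \<open>The contraction factor will be \<open>L / l\<close>, here at most 1/2; the
    summand 1 keeps \<open>l\<close> positive when \<open>L = 0\<close>.\<close>
  define l where "l = 2 * (L + 1)"
  have L0: "L \<ge> 0" using lip by (rule lipschitz_on_nonneg)
  have l0: "l > 0" using L0 by (simp add: l_def)
  have Ll: "L / l \<le> 1/2" using L0 by (simp add: l_def field_simps)
  obtain M where M: "\<And>x. norm (F x) \<le> M" using bdd by (auto simp: bounded_iff)
  have M0: "M \<ge> 0" using M[of 0] norm_ge_zero order_trans by blast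
  have contF: "continuous_on S F" for S
    using lipschitz_on_continuous_on[OF lip] continuous_on_subset by blast
  \<comment> \<open>The unknown \<open>u\<close> is the solution damped by
    \<open>exp (- l * s)\<close>, which makes it a bounded function; the factor
    \<open>exp (l * s)\<close> undoes the damping.\<close>
  define h where "h u s = F (exp (l * s) *\<^sub>R apply_bcontfun u s)" for u :: "real \<Rightarrow>\<^sub>C 'v" and s
  have conth: "continuous_on S (h u)" for u S
    unfolding h_def by (rule continuous_on_compose2[OF contF[of UNIV]]) (auto intro!: continuous_intros)
  have inth: "h u integrable_on {0..t}" for u t
    by (rule integrable_continuous_real[OF conth])
  define I where "I u t = integral {0..t} (h u)" for u t
  have dI: "(I u has_vector_derivative h u t) (at t within {0..})" if "t \<ge> 0" for u t
    unfolding I_def using that by (intro integral_has_vector_derivative_half_line conth)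
  have contI: "continuous_on {0..} (I u)" for u
    using dI has_vector_derivative_continuous
    by (fastforce simp: continuous_on_eq_continuous_within)
  \<comment> \<open>Bounded continuous functions live on the whole line, so \<open>max 0 t\<close>
    extends the image constantly to negative times.\<close>
  define G where "G u t = exp (- l * max 0 t) *\<^sub>R (p + I u (max 0 t))" for u t
  have contG: "continuous_on UNIV (G u)" for u
    unfolding G_def by (intro continuous_intros continuous_on_compose2[OF contI]) auto
  have boundG: "norm (G u t) \<le> norm p + M / l" for u t
  proof -
    define T where "T = max 0 t"
    have T0: "T \<ge> 0" by (simp add: T_def)
    have IM: "norm (I u T) \<le> M * (T - 0)" unfolding I_def
      by (rule integral_bound[OF T0 conth]) (simp add: h_def M)
    have "norm (G u t) \<le> exp (- l * T) * (norm p + norm (I u T))"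
      unfolding G_def T_def by (simp add: norm_triangle_ineq)
    also have "\<dots> \<le> exp (- l * T) * norm p + exp (- l * T) * (M * T)"
      using IM by (simp flip: distrib_left)
    also have "\<dots> \<le> norm p + M / l"
    proof (rule add_mono)
      show "exp (- l * T) * norm p \<le> norm p"
        using l0 T0 by (intro mult_left_le_one_le) auto
      \<comment> \<open>A bounded field lets the integral grow at most linearly, and the exponential
        weight absorbs this.\<close>
      show "exp (- l * T) * (M * T) \<le> M / l"
    proof -
      have "l * T \<le> exp (l * T)" using exp_ge_add_one_self[of "l*T"] by linarith
      then have "M * (l * T) \<le> M * exp (l * T)" using M0 by (intro mult_left_mono)
      then show ?thesis using l0 by (simp add: exp_minus field_simps)
    qed
    qed
    finally show ?thesis .
  qed
  have Gb: "G u \<in> bcontfun" for u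
    by (rule bcontfun_normI[OF contG boundG])
  define \<Gamma> where "\<Gamma> u = Bcontfun (G u)" for u
  have app: "apply_bcontfun (\<Gamma> u) = G u" for u
    unfolding \<Gamma>_def by (rule Bcontfun_inverse[OF Gb])
  have "dist (\<Gamma> u) (\<Gamma> v) \<le> 1/2 * dist u v" for u v
  proof (rule dist_bound)
    fix t :: real
    define T where "T = max 0 t"
    define d where "d = dist u v"
    have T0: "T \<ge> 0" by (simp add: T_def)
    have d0: "d \<ge> 0" by (simp add: d_def)
    have eint: "((\<lambda>s. L * d * exp (l * s)) has_integral (L * d / l * exp (l * T) - L * d / l * exp (l * 0))) {0..T}"
      using l0 by (intro fundamental_theorem_of_calculus T0)
        (auto intro!: derivative_eq_intros simp flip: has_real_derivative_iff_has_vector_derivative)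
    have "norm (I u T - I v T) = norm (integral {0..T} (\<lambda>s. h u s - h v s))"
      unfolding I_def by (simp add: integral_diff inth)
    also have "\<dots> \<le> integral {0..T} (\<lambda>s. L * d * exp (l * s))"
    proof (rule integral_norm_bound_integral)
      show "(\<lambda>s. h u s - h v s) integrable_on {0..T}" by (intro integrable_diff inth)
      show "(\<lambda>s. L * d * exp (l * s)) integrable_on {0..T}" using eint by blast
      fix s
      have "norm (h u s - h v s) \<le> L * norm (exp (l * s) *\<^sub>R apply_bcontfun u s - exp (l * s) *\<^sub>R apply_bcontfun v s)"
        unfolding h_def by (rule lipschitz_on_normD[OF lip]) auto
      also have "\<dots> = L * (exp (l * s) * dist (apply_bcontfun u s) (apply_bcontfun v s))"
        by (simp add: dist_norm flip: scaleR_diff_right)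
      also have "\<dots> \<le> L * (exp (l * s) * d)"
        using L0 dist_bounded[of u s v] by (intro mult_left_mono) (auto simp: d_def)
      finally show "norm (h u s - h v s) \<le> L * d * exp (l * s)" by (simp add: mult_ac)
    qed
    also have "\<dots> = L * d / l * exp (l * T) - L * d / l * exp (l * 0)"
      using eint by (rule integral_unique)
    also have "\<dots> \<le> L * d / l * exp (l * T)" using L0 l0 d0 by simp
    finally have le: "norm (I u T - I v T) \<le> L * d / l * exp (l * T)" .
    have "dist (G u t) (G v t) = exp (- l * T) * norm (I u T - I v T)"
      unfolding G_def dist_norm T_def[symmetric] by (simp flip: scaleR_diff_right)
    also have "\<dots> \<le> exp (- l * T) * (L * d / l * exp (l * T))"
      using le by (intro mult_left_mono) auto
    also have "\<dots> = L / l * d" by (simp add: exp_minus field_simps)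
    also have "\<dots> \<le> 1/2 * d" using Ll d0 by (intro mult_right_mono)
    finally show "dist (apply_bcontfun (\<Gamma> u) t) (apply_bcontfun (\<Gamma> v) t) \<le> 1/2 * dist u v"
      by (simp add: app d_def)
  qed
  then obtain u where u: "\<Gamma> u = u"
    using banach_fix_type[of "1/2" \<Gamma>] by auto
  define \<phi> where "\<phi> t = p + I u t" for t
  have ut: "exp (l * t) *\<^sub>R apply_bcontfun u t = \<phi> t" if "t \<ge> 0" for t
  proof -
    have "apply_bcontfun u t = exp (- l * t) *\<^sub>R \<phi> t"
      using app[of u] that by (simp add: u G_def \<phi>_def)
    then show ?thesis by (simp add: exp_minus)
  qed
  have "forward_solution F p \<phi>"
    unfolding forward_solution_def
  proof (intro conjI allI impI)
    show "\<phi> 0 = p" by (simp add: \<phi>_def I_def)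
    fix t :: real assume t: "t \<ge> 0"
    have "(\<phi> has_vector_derivative 0 + h u t) (at t within {0..})"
      unfolding \<phi>_def by (intro has_vector_derivative_add has_vector_derivative_const dI[OF t])
    then show "(\<phi> has_vector_derivative F (\<phi> t)) (at t within {0..})"
      by (simp add: h_def ut[OF t])
  qed
  then show ?thesis by blast
qed

section \<open>Lyapunov functions\<close>

lemma forward_solution_continuous_on:
  "forward_solution F p \<phi> \<Longrightarrow> continuous_on {0..} \<phi>"
  unfolding forward_solution_def continuous_on_eq_continuous_within
  by (auto intro: has_vector_derivative_continuous)

text \<open>\<open>V (\<phi> r) - c * r\<close> has nonpositive derivative. The hypotheses concern
  only points of the orbit between \<open>s\<close> and \<open>t\<close>, so the estimate is
  available before invariance is known.\<close>

lemma forward_solution_decrease: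
  assumes sol: "forward_solution F p \<phi>" and st: "0 \<le> s" "s \<le> t"
    and der: "\<And>r. s \<le> r \<Longrightarrow> r \<le> t \<Longrightarrow> (V has_derivative V' (\<phi> r)) (at (\<phi> r))"
    and le: "\<And>r. s \<le> r \<Longrightarrow> r \<le> t \<Longrightarrow> V' (\<phi> r) (F (\<phi> r)) \<le> c"
  shows "V (\<phi> t) \<le> V (\<phi> s) + c * (t - s)"
proof -
  let ?h = "\<lambda>r. V (\<phi> r) - c * r"
  have chain: "((\<lambda>r. V (\<phi> r)) has_real_derivative V' (\<phi> r) (F (\<phi> r))) (at r within {0..})"
    if "s \<le> r" "r \<le> t" for r
  proof -
    have "(\<phi> has_vector_derivative F (\<phi> r)) (at r within {0..})"
      using sol that st by (simp add: forward_solution_def)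
    then show ?thesis
      using vector_derivative_diff_chain_within[of \<phi> "F (\<phi> r)" r "{0..}" V "V' (\<phi> r)"]
        has_derivative_at_withinI[OF der[OF that]]
      by (simp add: has_real_derivative_iff_has_vector_derivative o_def)
  qed
  have "?h t \<le> ?h s"
  proof (rule DERIV_nonpos_imp_decreasing_open[OF st(2)])
    fix r assume r: "s < r" "r < t"
    have "at r within {0..} = at r"
      using r st by (intro at_within_interior) auto
    then have "((\<lambda>r. V (\<phi> r)) has_real_derivative V' (\<phi> r) (F (\<phi> r))) (at r)"
      using chain[of r] r by simp
    then have "(?h has_real_derivative V' (\<phi> r) (F (\<phi> r)) - c) (at r)"
      by (auto intro!: derivative_eq_intros)
    then show "\<exists>y. (?h has_real_derivative y) (at r) \<and> y \<le> 0"
      using le[of r] r by force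
  next
    have "continuous (at r within {s..t}) (\<lambda>r. V (\<phi> r))" if "r \<in> {s..t}" for r
      by (rule continuous_within_subset[OF DERIV_continuous[OF chain[of r]]]) (use that st in auto)
    then have "continuous_on {s..t} (\<lambda>r. V (\<phi> r))"
      by (simp add: continuous_on_eq_continuous_within)
    then show "continuous_on {s..t} ?h" by (intro continuous_intros)
  qed
  then show ?thesis by (simp add: algebra_simps)
qed

text \<open>Up to a first exit time the solution stays in the compact sublevel set. That set is
  closed and contained in \<open>U\<close>, so the solution is still in \<open>U\<close> at the exit
  time, a contradiction.\<close>

lemma lyapunov_invariant:
  fixes V :: "'v::real_normed_vector \<Rightarrow> real"
  assumes "open U" and p: "p \<in> U"
    and der: "\<And>z. z \<in> U \<Longrightarrow> (V has_derivative V' z) (at z)"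
    and le: "\<And>z. z \<in> U \<Longrightarrow> V' z (F z) \<le> 0"
    and comp: "compact {z \<in> U. V z \<le> V p}"
    and sol: "forward_solution F p \<phi>" and t: "t \<ge> 0"
  shows "\<phi> t \<in> U" and "V (\<phi> t) \<le> V p"
proof -
  let ?K = "{z \<in> U. V z \<le> V p}"
  have cont: "continuous_on {0..} \<phi>" using sol by (rule forward_solution_continuous_on)
  have p0: "\<phi> 0 = p" using sol by (simp add: forward_solution_def)
  have Vle: "V (\<phi> s) \<le> V p" if "s \<ge> 0" and "\<And>r. 0 \<le> r \<Longrightarrow> r \<le> s \<Longrightarrow> \<phi> r \<in> U" for s
    using forward_solution_decrease[OF sol order_refl \<open>s \<ge> 0\<close>, of V V' 0] der le that p0 by simp
  have U: "\<phi> t \<in> U" if "t \<ge> 0" for t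
  proof (rule ccontr)
    assume notU: "\<phi> t \<notin> U"
    \<comment> \<open>The times outside \<open>U\<close> form a closed set, so a first one
      exists.\<close>
    define B where "B = {0..} \<inter> \<phi> -` (- U)"
    have "closed B" unfolding B_def
      using cont \<open>open U\<close> by (intro continuous_closed_preimage) auto
    moreover have "B \<noteq> {}" "bdd_below B"
      using notU that by (auto simp: B_def intro!: bdd_belowI[of _ 0])
    ultimately have T: "Inf B \<in> B" by (intro closed_contains_Inf)
    define T where "T = Inf B"
    have T0: "T > 0" using T p0 p by (cases "T = 0") (auto simp: B_def T_def)
    have before: "\<phi> r \<in> U" if "0 \<le> r" "r < T" for r
      using that cInf_lower[of r B] \<open>bdd_below B\<close> by (force simp: B_def T_def)
    have "{0..<T} \<subseteq> {0..T} \<inter> \<phi> -` ?K"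
      using before Vle by auto
    moreover have "closed ({0..T} \<inter> \<phi> -` ?K)"
      using cont comp by (intro continuous_closed_preimage) (auto intro: continuous_on_subset compact_imp_closed)
    ultimately have "closure {0..<T} \<subseteq> {0..T} \<inter> \<phi> -` ?K" by (rule closure_minimal)
    moreover have "T \<in> closure {0..<T}" using T0 by simp
    ultimately have "T \<in> {0..T} \<inter> \<phi> -` ?K" by (rule subsetD)
    then have "\<phi> T \<in> U" by blast
    then show False using T by (simp add: B_def T_def)
  qed
  show "\<phi> t \<in> U" using U t by blast
  show "V (\<phi> t) \<le> V p" using Vle U t by blast
qed

text \<open>Composing \<open>F\<close> with the nearest-point projection onto a ball around the
  sublevel set gives a bounded, globally Lipschitz field. Its solution never leaves the ball, where
  it agrees with \<open>F\<close>.\<close>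

lemma forward_solution_exists_lyapunov:
  fixes V :: "'v::euclidean_space \<Rightarrow> real"
  assumes "open U" and p: "p \<in> U"
    and der: "\<And>z. z \<in> U \<Longrightarrow> (V has_derivative V' z) (at z)"
    and le: "\<And>z. z \<in> U \<Longrightarrow> V' z (F z) \<le> 0"
    and comp: "compact {z \<in> U. V z \<le> V p}"
    and lip: "\<And>r. \<exists>L. L-lipschitz_on (cball 0 r) F"
  shows "\<exists>\<phi>. forward_solution F p \<phi>"
proof -
  obtain r where r: "r > 0" "{z \<in> U. V z \<le> V p} \<subseteq> ball 0 r"
    using compact_imp_bounded[OF comp] bounded_subset_ballD by blast
  obtain L where L: "L-lipschitz_on (cball 0 r) F" using lip by blast
  define c where "c = closest_point (cball (0::'v) r)"
  have c_in: "c z \<in> cball 0 r" for z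
    unfolding c_def using r by (intro closest_point_in_set) auto
  have "1-lipschitz_on UNIV c"
    unfolding c_def using r by (intro lipschitz_onI) (simp_all add: closest_point_lipschitz)
  then have "(L * 1)-lipschitz_on UNIV (\<lambda>z. F (c z))"
    by (rule lipschitz_on_compose2) (rule lipschitz_on_subset[OF L], use c_in in blast)
  moreover have "bounded (range (\<lambda>z. F (c z)))"
  proof (rule bounded_subset)
    show "bounded (F ` cball 0 r)"
      using lipschitz_on_continuous_on[OF L]
      by (intro compact_imp_bounded compact_continuous_image) auto
  qed (use c_in in auto)
  ultimately obtain \<phi> where \<phi>: "forward_solution (\<lambda>z. F (c z)) p \<phi>"
    using forward_solution_exists_lipschitz by blast
  have Fc: "F (c z) = F z" if "z \<in> ball 0 r" for z
    unfolding c_def using that by (subst closest_point_self) auto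
  \<comment> \<open>Restricting to the open ball, where both fields agree, keeps the sublevel set
    and hence its compactness.\<close>
  have eq: "{z \<in> U \<inter> ball 0 r. V z \<le> V p} = {z \<in> U. V z \<le> V p}" using r by auto
  have "\<phi> t \<in> U \<inter> ball 0 r" if "t \<ge> 0" for t
  proof (rule lyapunov_invariant(1)[OF _ _ _ _ _ \<phi> that])
    show "open (U \<inter> ball 0 r)" using \<open>open U\<close> by auto
    show "p \<in> U \<inter> ball 0 r" using p r by auto
    show "compact {z \<in> U \<inter> ball 0 r. V z \<le> V p}" using comp unfolding eq .
    show "(V has_derivative V' z) (at z)" if "z \<in> U \<inter> ball 0 r" for z using der that by simp
    show "V' z (F (c z)) \<le> 0" if "z \<in> U \<inter> ball 0 r" for z using le Fc that by simp
  qed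
  then have "forward_solution F p \<phi>"
    using \<phi> Fc by (auto simp: forward_solution_def)
  then show ?thesis by blast
qed

text \<open>The minimum of \<open>V\<close> over the compact set \<open>K - ball P e\<close> is
  positive and serves as the level.\<close>

lemma small_sublevel:
  fixes V :: "'v::metric_space \<Rightarrow> real"
  assumes comp: "compact K" and cont: "continuous_on K V"
    and pos: "\<And>z. z \<in> K \<Longrightarrow> z \<noteq> P \<Longrightarrow> V z > 0" and e: "e > 0"
  obtains c where "c > 0" and "\<And>z. z \<in> K \<Longrightarrow> V z < c \<Longrightarrow> z \<in> ball P e"
proof (cases "K - ball P e = {}")
  case True
  then show ?thesis using that[of 1] by (metis Diff_iff emptyE zero_less_one)
next
  case False
  have "compact (K - ball P e)" using comp by (simp add: compact_diff)
  then obtain z where z: "z \<in> K - ball P e" "\<And>w. w \<in> K - ball P e \<Longrightarrow> V z \<le> V w"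
    using continuous_attains_inf[OF _ False continuous_on_subset[OF cont Diff_subset]] by blast
  have "V z > 0" using z(1) e by (intro pos) auto
  then show ?thesis using that[of "V z"] z(2) by force
qed

text \<open>
  \<open>V\<close> alone confines a solution to a compact sublevel set \<open>K\<close>; \<open>W\<close> is strictly decreasing along
  solutions in \<open>K\<close> but its own sublevel sets play no role. Were \<open>V\<close> to stay above a positive
  level, \<open>W\<close> would decrease at a uniform rate and be unbounded on \<open>K\<close>.
\<close>

lemma lyapunov_convergence:
  fixes V W :: "'v::real_normed_vector \<Rightarrow> real"
  assumes "open U" and p: "p \<in> U"
    and V: "\<And>z. z \<in> U \<Longrightarrow> (V has_derivative V' z) (at z)"
    and W: "\<And>z. z \<in> U \<Longrightarrow> (W has_derivative W' z) (at z)"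
    and V_le: "\<And>z. z \<in> U \<Longrightarrow> V' z (F z) \<le> 0"
    and comp: "compact {z \<in> U. V z \<le> V p}"
    and V_P: "V P = 0" and V_pos: "\<And>z. z \<in> U \<Longrightarrow> z \<noteq> P \<Longrightarrow> V z > 0"
    and W_less: "\<And>z. z \<in> U \<Longrightarrow> V z \<le> V p \<Longrightarrow> z \<noteq> P \<Longrightarrow> W' z (F z) < 0"
    and W_cont: "continuous_on U (\<lambda>z. W' z (F z))"
    and sol: "forward_solution F p \<phi>"
  shows "(\<phi> \<longlongrightarrow> P) at_top"
proof -
  define K where "K = {z \<in> U. V z \<le> V p}"
  have inK: "\<phi> t \<in> K" if "t \<ge> 0" for t
    using lyapunov_invariant[OF \<open>open U\<close> p V V_le comp sol that] by (simp add: K_def)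
  have contV: "continuous_on K V" and contW: "continuous_on K W"
    using has_derivative_continuous[OF V] has_derivative_continuous[OF W]
    by (auto simp: K_def intro: continuous_at_imp_continuous_on)
  have cK: "compact K" using comp by (simp add: K_def)
  have mono: "V (\<phi> t) \<le> V (\<phi> s)" if "0 \<le> s" "s \<le> t" for s t
  proof -
    have "\<phi> r \<in> U" if "s \<le> r" for r using inK[of r] \<open>0 \<le> s\<close> that by (simp add: K_def)
    then show ?thesis
      using forward_solution_decrease[OF sol that, of V V' 0] V V_le by simp
  qed
  have small: "\<exists>t\<ge>0. V (\<phi> t) < c" if c: "c > 0" for c
  proof (rule ccontr)
    assume "\<not> ?thesis"
    then have ge: "V (\<phi> t) \<ge> c" if "t \<ge> 0" for t using that by force
    \<comment> \<open>This compact set contains the orbit but not \<open>P\<close>, so the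
      derivative of \<open>W\<close> has a negative maximum on it.\<close>
    define C where "C = K \<inter> V -` {c..}"
    have "closed C"
      unfolding C_def using contV compact_imp_closed[OF cK] by (intro continuous_closed_preimage) auto
    moreover have "C = K \<inter> C" by (auto simp: C_def)
    ultimately have cC: "compact C" using compact_Int_closed[OF cK, of C] by simp
    have inC: "\<phi> t \<in> C" if "t \<ge> 0" for t using inK ge that by (simp add: C_def)
    then have "C \<noteq> {}" by force
    moreover have "continuous_on C (\<lambda>z. W' z (F z))"
      using W_cont by (rule continuous_on_subset) (auto simp: C_def K_def)
    ultimately obtain m where m: "m \<in> C" "\<And>z. z \<in> C \<Longrightarrow> W' z (F z) \<le> W' m (F m)"
      using continuous_attains_sup[OF cC] by blast
    define d where "d = W' m (F m)"
    have d: "d < 0" unfolding d_def using m(1) c V_P by (intro W_less) (auto simp: C_def K_def)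
    have "bounded (W ` K)" using contW cK by (intro compact_imp_bounded compact_continuous_image)
    then obtain M where M: "\<And>z. z \<in> K \<Longrightarrow> \<bar>W z\<bar> \<le> M" by (auto simp: bounded_iff)
    \<comment> \<open>By this time \<open>W\<close> has dropped by at least
      \<open>2 * M + 1\<close>, more than its oscillation on \<open>K\<close> permits.\<close>
    define T where "T = (2 * M + 1) / (- d)"
    have "M \<ge> 0" using M[OF inK[of 0]] by simp
    then have T0: "T \<ge> 0" using d by (simp add: T_def field_simps)
    have "W (\<phi> T) \<le> W (\<phi> 0) + d * (T - 0)"
      using inC T0 m(2) by (intro forward_solution_decrease[OF sol _ _ W])
        (auto simp: C_def K_def d_def)
    moreover have "d * T = - (2 * M + 1)" using d by (simp add: T_def)
    ultimately show False using M[OF inK[of 0]] M[OF inK[OF T0]] by simp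
  qed
  show ?thesis
  proof (rule tendstoI)
    fix e :: real assume "e > 0"
    then obtain c where c: "c > 0" "\<And>z. z \<in> K \<Longrightarrow> V z < c \<Longrightarrow> z \<in> ball P e"
      using small_sublevel[OF cK contV, of P e] V_pos by (auto simp: K_def)
    then obtain s where s: "s \<ge> 0" "V (\<phi> s) < c" using small by blast
    have "dist (\<phi> t) P < e" if "t \<ge> s" for t
      using c(2)[OF inK[of t]] mono[OF s(1) that] s that by (auto simp: dist_commute)
    then show "\<forall>\<^sub>F t in at_top. dist (\<phi> t) P < e"
      unfolding eventually_at_top_linorder by blast
  qed
qed

section \<open>The planar system\<close>

text \<open>Lipschitz functions are bounded on a bounded set, so the usual splitting of a difference
  of products applies.\<close>

lemma lipschitz_on_mult_bounded:
  fixes f g :: "'a::metric_space \<Rightarrow> real"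
  assumes "bounded S" and "\<exists>L. L-lipschitz_on S f" and "\<exists>L. L-lipschitz_on S g"
  shows "\<exists>L. L-lipschitz_on S (\<lambda>x. f x * g x)"
proof (cases "S = {}")
  case True
  then show ?thesis by (auto intro: exI[of _ 0])
next
  case False
  then obtain z0 where z0: "z0 \<in> S" by blast
  obtain r where r: "\<And>x. x \<in> S \<Longrightarrow> dist z0 x \<le> r"
    using \<open>bounded S\<close> by (metis bounded_any_center)
  have bdd: "\<exists>M\<ge>0. \<forall>x\<in>S. \<bar>h x\<bar> \<le> M" if h: "L-lipschitz_on S h" for h :: "'a \<Rightarrow> real" and L
  proof -
    have "\<bar>h x\<bar> \<le> \<bar>h z0\<bar> + L * r" if "x \<in> S" for x
    proof -
      have "dist (h z0) (h x) \<le> L * dist z0 x" by (rule lipschitz_onD[OF h z0 that])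
      also have "\<dots> \<le> L * r" using r[OF that] lipschitz_on_nonneg[OF h] by (rule mult_left_mono)
      finally show ?thesis by (simp add: dist_real_def)
    qed
    then show ?thesis by (intro exI[of _ "\<bar>h z0\<bar> + L * r"]) (use z0 in force)
  qed
  obtain Lf Lg where L: "Lf-lipschitz_on S f" "Lg-lipschitz_on S g" using assms by blast
  obtain M N where M: "M \<ge> 0" "\<And>x. x \<in> S \<Longrightarrow> \<bar>f x\<bar> \<le> M"
    and N: "N \<ge> 0" "\<And>x. x \<in> S \<Longrightarrow> \<bar>g x\<bar> \<le> N"
    using bdd[OF L(1)] bdd[OF L(2)] by blast
  have "(M * Lg + N * Lf)-lipschitz_on S (\<lambda>x. f x * g x)"
  proof (rule lipschitz_onI)
    fix x y assume xy: "x \<in> S" "y \<in> S"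
    have "dist (f x * g x) (f y * g y) = \<bar>f x * (g x - g y) + g y * (f x - f y)\<bar>"
      by (simp add: dist_real_def algebra_simps)
    also have "\<dots> \<le> \<bar>f x\<bar> * dist (g x) (g y) + \<bar>g y\<bar> * dist (f x) (f y)"
      by (simp add: dist_real_def flip: abs_mult)
    also have "\<dots> \<le> M * (Lg * dist x y) + N * (Lf * dist x y)"
      using xy M N L by (intro add_mono mult_mono) (auto dest: lipschitz_onD)
    finally show "dist (f x * g x) (f y * g y) \<le> (M * Lg + N * Lf) * dist x y"
      by (simp add: algebra_simps)
  next
    show "0 \<le> M * Lg + N * Lf" using M(1) N(1) L by (simp add: lipschitz_on_nonneg)
  qed
  then show ?thesis by blast
qed

text \<open>Both components are polynomials, built from constants and projections by sums,
  differences and products.\<close>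

lemma planar_field_lipschitz: "\<exists>L. L-lipschitz_on (cball 0 r) (planar_field a b)"
proof -
  define S where "S = cball (0 :: real \<times> real) r"
  have S: "bounded S" by (simp add: S_def)
  define lip where "lip h = (\<exists>L. L-lipschitz_on S h)" for h :: "real \<times> real \<Rightarrow> real"
  have const: "lip (\<lambda>z. c)" for c unfolding lip_def using lipschitz_on_constant by blast
  have add: "lip (\<lambda>z. f z + g z)" if "lip f" "lip g" for f g
    using that unfolding lip_def by (elim exE) (rule exI, rule lipschitz_on_add)
  have diff: "lip (\<lambda>z. f z - g z)" if "lip f" "lip g" for f g
    using that unfolding lip_def by (elim exE) (rule exI, rule lipschitz_on_diff)
  have mult: "lip (\<lambda>z. f z * g z)" if "lip f" "lip g" for f g
    using that lipschitz_on_mult_bounded[OF S] unfolding lip_def by blast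
  have "1-lipschitz_on S fst" "1-lipschitz_on S snd"
    by (intro lipschitz_onI; simp only: mult_1 dist_fst_le dist_snd_le zero_le_one)+
  then have proj: "lip (\<lambda>z. fst z)" "lip (\<lambda>z. snd z)" unfolding lip_def by auto
  have "lip (\<lambda>z. (a - fst z) * (1 + fst z * fst z) - 4 * fst z * snd z)"
    "lip (\<lambda>z. b * fst z * (1 + fst z * fst z - snd z))"
    by (intro const add diff mult proj)+
  then have "\<exists>L. L-lipschitz_on S (\<lambda>z. ((a - fst z) * (1 + fst z * fst z) - 4 * fst z * snd z,
      b * fst z * (1 + fst z * fst z - snd z)))"
    unfolding lip_def by (elim exE) (rule exI, rule lipschitz_on_Pair)
  then show ?thesis
    by (simp add: S_def planar_field_def case_prod_unfold power2_eq_square)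
qed

section \<open>Lienard variables, energy and their derivatives along the flow\<close>

definition speed :: "real \<Rightarrow> real \<times> real \<Rightarrow> real" where
  "speed a z = a / fst z + a * fst z - 1 - (fst z)\<^sup>2 - 4 * snd z"

definition damping :: "real \<Rightarrow> real \<Rightarrow> real \<Rightarrow> real" where
  "damping a b x = b - (a - a / x\<^sup>2 - 2 * x)"

text \<open>This is \<open>k\<close> multiplied out, so that it differentiates and integrates term
  by term; \<open>restoring_factor\<close> gives the factored form that shows its sign.\<close>

definition restoring :: "real \<Rightarrow> real \<Rightarrow> real" where
  "restoring a x = 5 + 5 * x\<^sup>2 - a / x - a * x"

definition potential :: "real \<Rightarrow> real \<Rightarrow> real" where
  "potential a x = 5 * x + 5 * x ^ 3 / 3 - a * ln x - a * x\<^sup>2 / 2"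

text \<open>Subtracting the potential at \<open>a / 5\<close> normalizes the energy to 0 at the
  equilibrium.\<close>

definition energy :: "real \<Rightarrow> real \<Rightarrow> real \<times> real \<Rightarrow> real" where
  "energy a b z = (speed a z)\<^sup>2 / 2 + b * (potential a (fst z) - potential a (a / 5))"

definition energy_deriv :: "real \<Rightarrow> real \<Rightarrow> real \<times> real \<Rightarrow> real \<times> real \<Rightarrow> real" where
  "energy_deriv a b z h =
     speed a z * ((a - a / (fst z)\<^sup>2 - 2 * fst z) * fst h - 4 * snd h) + b * restoring a (fst z) * fst h"

text \<open>Its derivative along solutions contains \<open>- b * x * k\<^sup>2\<close>, which
  supplies decay where the speed vanishes and the energy is stationary.\<close>

definition cross :: "real \<Rightarrow> real \<times> real \<Rightarrow> real" where
  "cross a z = speed a z * restoring a (fst z)"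

definition cross_deriv :: "real \<Rightarrow> real \<times> real \<Rightarrow> real \<times> real \<Rightarrow> real" where
  "cross_deriv a z h =
     ((a - a / (fst z)\<^sup>2 - 2 * fst z) * fst h - 4 * snd h) * restoring a (fst z)
     + speed a z * ((10 * fst z + a / (fst z)\<^sup>2 - a) * fst h)"

lemma speed_has_derivative:
  assumes "fst z > 0"
  shows "(speed a has_derivative (\<lambda>h. (a - a / (fst z)\<^sup>2 - 2 * fst z) * fst h - 4 * snd h)) (at z)"
proof -
  have "((\<lambda>z. a / fst z + a * fst z - 1 - (fst z)\<^sup>2 - 4 * snd z) has_derivative
      (\<lambda>h. (a - a / (fst z)\<^sup>2 - 2 * fst z) * fst h - 4 * snd h)) (at z)"
    using assms by (auto intro!: derivative_eq_intros simp: fun_eq_iff field_simps power2_eq_square)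
  then show ?thesis by (simp add: speed_def[abs_def])
qed

lemma restoring_has_derivative:
  assumes "x > 0"
  shows "(restoring a has_real_derivative (10 * x + a / x\<^sup>2 - a)) (at x)"
  unfolding restoring_def[abs_def] using assms
  by (auto intro!: derivative_eq_intros simp: field_simps power2_eq_square)

lemma potential_has_derivative:
  assumes "x > 0"
  shows "(potential a has_real_derivative restoring a x) (at x)"
  unfolding potential_def[abs_def] restoring_def using assms
  by (auto intro!: derivative_eq_intros simp: field_simps power2_eq_square)

lemma has_derivative_comp_fst:
  assumes "(f has_real_derivative d) (at (fst z))"
  shows "((\<lambda>z. f (fst z)) has_derivative (\<lambda>h. d * fst h)) (at z)"
  using DERIV_compose_FDERIV[OF assms has_derivative_fst[OF has_derivative_ident]]
  by (simp add: mult.commute)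

lemma energy_has_derivative:
  assumes "fst z > 0"
  shows "(energy a b has_derivative energy_deriv a b z) (at z)"
proof -
  have "((\<lambda>s. s\<^sup>2 / 2) has_real_derivative speed a z) (at (speed a z))"
    by (auto intro!: derivative_eq_intros)
  note kinetic = DERIV_compose_FDERIV[OF this speed_has_derivative[OF assms]]
  have "((\<lambda>x. b * (potential a x - potential a (a / 5))) has_real_derivative b * restoring a (fst z)) (at (fst z))"
    by (rule derivative_eq_intros potential_has_derivative[OF assms] refl)+ simp
  note pot = has_derivative_comp_fst[OF this]
  show ?thesis
    unfolding energy_def[abs_def] energy_deriv_def[abs_def]
    using has_derivative_add[OF kinetic pot] by (simp add: mult.commute)
qed

lemma continuous_on_energy:
  "(\<And>z. z \<in> S \<Longrightarrow> fst z > 0) \<Longrightarrow> continuous_on S (energy a b)"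
  using has_derivative_continuous[OF energy_has_derivative]
  by (auto intro: continuous_at_imp_continuous_on)

lemma cross_has_derivative:
  assumes "fst z > 0"
  shows "(cross a has_derivative cross_deriv a z) (at z)"
  unfolding cross_def[abs_def] cross_deriv_def[abs_def]
  using has_derivative_mult[OF speed_has_derivative[OF assms]
      has_derivative_comp_fst[OF restoring_has_derivative[OF assms]], of a a]
  by (simp add: add.commute)

lemma planar_field_eq:
  assumes "fst z > 0"
  shows "planar_field a b z = (fst z * speed a z, b * fst z * (1 + (fst z)\<^sup>2 - snd z))"
  using assms by (cases z) (simp add: planar_field_def speed_def field_simps power2_eq_square)

text \<open>This is the Lienard form: with \<open>w\<close> the speed and \<open>k\<close> the
  restoring force, \<open>4 * (1 + x\<^sup>2 - y) = k + w\<close>, so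
  \<open>y' = b * x * (k + w) / 4\<close>.\<close>

lemma speed_deriv_planar_field:
  assumes "fst z > 0"
  shows "(a - a / (fst z)\<^sup>2 - 2 * fst z) * fst (planar_field a b z) - 4 * snd (planar_field a b z)
    = - fst z * (damping a b (fst z) * speed a z + b * restoring a (fst z))"
  unfolding planar_field_eq[OF assms] speed_def damping_def restoring_def
  by (simp add: algebra_simps power2_eq_square)

text \<open>The contributions of the restoring force to the kinetic and potential parts cancel,
  leaving only dissipation.\<close>

lemma energy_deriv_planar_field:
  assumes "fst z > 0"
  shows "energy_deriv a b z (planar_field a b z) = - fst z * damping a b (fst z) * (speed a z)\<^sup>2"
  unfolding energy_deriv_def speed_deriv_planar_field[OF assms]
  by (simp add: planar_field_eq[OF assms] algebra_simps power2_eq_square)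

lemma cross_deriv_planar_field:
  assumes "fst z > 0"
  shows "cross_deriv a z (planar_field a b z) = fst z *
    ((10 * fst z + a / (fst z)\<^sup>2 - a) * (speed a z)\<^sup>2
      - damping a b (fst z) * speed a z * restoring a (fst z) - b * (restoring a (fst z))\<^sup>2)"
  unfolding cross_deriv_def speed_deriv_planar_field[OF assms]
  by (simp add: planar_field_eq[OF assms] algebra_simps power2_eq_square)

section \<open>Positive definiteness and properness of the energy\<close>

lemma restoring_factor: "x > 0 \<Longrightarrow> restoring a x = (5 * x - a) * (1 + x\<^sup>2) / x"
  by (simp add: restoring_def field_simps power2_eq_square)

text \<open>The derivative has the sign of \<open>5 * x - a\<close>, so the potential is strictly
  monotone on each side of \<open>a / 5\<close>.\<close>

lemma potential_greater:
  assumes "a > 0" and "x > 0" and "x \<noteq> a / 5"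
  shows "potential a x > potential a (a / 5)"
proof (cases "x > a / 5")
  case True
  show ?thesis
  proof (rule DERIV_pos_imp_increasing_open[OF True])
    fix y assume "a / 5 < y" "y < x"
    then show "\<exists>d. (potential a has_real_derivative d) (at y) \<and> d > 0"
      using potential_has_derivative[of y a] restoring_factor[of y a] assms
      by (intro exI[of _ "restoring a y"]) (auto intro!: divide_pos_pos mult_pos_pos add_pos_nonneg)
  next
    show "continuous_on {a / 5..x} (potential a)"
    proof (rule DERIV_continuous_on)
      fix y assume "y \<in> {a / 5..x}"
      then have "y > 0" using \<open>a > 0\<close> by simp
      then show "(potential a has_real_derivative restoring a y) (at y within {a / 5..x})"
        by (rule has_field_derivative_at_within[OF potential_has_derivative])
    qed
  qed
next
  case False
  then have less: "x < a / 5" using assms by simp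
  show ?thesis
  proof (rule DERIV_neg_imp_decreasing_open[OF less])
    fix y assume "x < y" "y < a / 5"
    then show "\<exists>d. (potential a has_real_derivative d) (at y) \<and> d < 0"
      using potential_has_derivative[of y a] restoring_factor[of y a] assms
      by (intro exI[of _ "restoring a y"])
        (auto intro!: divide_neg_pos mult_neg_pos add_pos_nonneg)
  next
    show "continuous_on {x..a / 5} (potential a)"
      using assms by (intro DERIV_continuous_on[where D = "restoring a"]
        has_field_derivative_at_within[OF potential_has_derivative]) auto
  qed
qed

lemma speed_eq_0_iff: "speed a z = 0 \<longleftrightarrow> snd z = (a / fst z + a * fst z - 1 - (fst z)\<^sup>2) / 4"
  by (auto simp: speed_def)

lemma speed_equilibrium:
  assumes "a > 0" shows "speed a (equilibrium_point a) = 0"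
  using assms by (simp add: speed_def equilibrium_point_def field_simps power2_eq_square)

lemma eq_equilibrium_point:
  assumes "a > 0" and "fst z = a / 5" and "speed a z = 0"
  shows "z = equilibrium_point a"
proof -
  have "fst z = fst (equilibrium_point a)" using assms(2) by (simp add: equilibrium_point_def)
  then show ?thesis
    using assms(3) speed_equilibrium[OF assms(1)] by (simp add: prod_eq_iff speed_eq_0_iff)
qed

lemma energy_equilibrium: "a > 0 \<Longrightarrow> energy a b (equilibrium_point a) = 0"
  by (simp add: energy_def speed_equilibrium) (simp add: equilibrium_point_def)

lemma energy_pos:
  assumes "a > 0" "b > 0" "fst z > 0" "z \<noteq> equilibrium_point a"
  shows "energy a b z > 0"
proof (cases "fst z = a / 5")
  case True
  then have "speed a z \<noteq> 0" using eq_equilibrium_point assms by blast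
  then show ?thesis by (simp add: energy_def True)
next
  case False
  then have "b * (potential a (fst z) - potential a (a / 5)) > 0"
    using potential_greater assms by simp
  then show ?thesis by (simp add: energy_def add_nonneg_pos)
qed

text \<open>The potential tends to infinity at 0 (logarithm) and at infinity (cubic term), which
  confines \<open>x\<close>; the kinetic part then bounds the speed. In the coordinates position and
  speed the sublevel set is a closed part of a rectangle.\<close>

lemma compact_energy_sublevel:
  assumes "a > 0" "b > 0"
  shows "compact {z. fst z > 0 \<and> energy a b z \<le> c}"
proof -
  define C where "C = c / b + potential a (a / 5)"
  have "filterlim (potential a) at_top (at_right 0)"
    unfolding potential_def[abs_def] using \<open>a > 0\<close> by real_asymp
  then have "eventually (\<lambda>x. potential a x > C) (at_right 0)"
    by (simp add: filterlim_at_top_dense)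
  then obtain l where l: "l > 0" "\<And>x. 0 < x \<Longrightarrow> x < l \<Longrightarrow> potential a x > C"
    by (auto simp: eventually_at_right_field)
  have "filterlim (potential a) at_top at_top"
    unfolding potential_def[abs_def] using \<open>a > 0\<close> by real_asymp
  then have "eventually (\<lambda>x. potential a x > C) at_top"
    by (simp add: filterlim_at_top_dense)
  then obtain u where u: "\<And>x. u \<le> x \<Longrightarrow> potential a x > C"
    by (auto simp: eventually_at_top_linorder)
  define r where "r = sqrt (2 * \<bar>c\<bar>)"
  \<comment> \<open>The inverse of the coordinate change from \<open>z\<close> to
    \<open>(fst z, speed a z)\<close>, obtained by solving for \<open>y\<close>.\<close>
  define T where "T q = (fst q, (a / fst q + a * fst q - 1 - (fst q)\<^sup>2 - snd q) / 4)" for q :: "real \<times> real"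
  define R where "R = {l..u} \<times> {-r..r}"
  have "e - 4 * ((e - s) / 4) = s" for e s :: real by (simp add: field_simps)
  then have speed_T: "speed a (T q) = snd q" for q
    unfolding speed_def T_def fst_conv snd_conv .
  have contT: "continuous_on R T"
    unfolding T_def R_def using l by (intro continuous_intros) auto
  have pos: "fst q > 0" if "q \<in> R" for q using that l by (auto simp: R_def)
  have cont: "continuous_on R (\<lambda>q. energy a b (T q))"
  proof (rule continuous_on_compose2[OF _ contT])
    show "continuous_on {z. fst z > 0} (energy a b)"
      by (rule continuous_on_energy) auto
    show "T ` R \<subseteq> {z. fst z > 0}" using pos by (auto simp: T_def)
  qed
  have "{z. fst z > 0 \<and> energy a b z \<le> c} = T ` (R \<inter> (\<lambda>q. energy a b (T q)) -` {..c})"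
  proof (intro equalityI subsetI)
    fix z assume "z \<in> {z. fst z > 0 \<and> energy a b z \<le> c}"
    then have z: "fst z > 0" "energy a b z \<le> c" by auto
    define x where "x = fst z"
    have x: "x > 0" using z by (simp add: x_def)
    have "b * (potential a x - potential a (a / 5)) \<le> c"
      using z(2) zero_le_power2[of "speed a z"] unfolding energy_def x_def by linarith
    then have "potential a x \<le> C" using \<open>b > 0\<close> by (simp add: C_def field_simps)
    then have "x \<in> {l..u}" using l(2)[of x] u[of x] x by force
    moreover have "speed a z \<in> {-r..r}"
    proof -
      have "b * (potential a x - potential a (a / 5)) \<ge> 0"
        using potential_greater[OF \<open>a > 0\<close> x] \<open>b > 0\<close> by (cases "x = a / 5") (auto simp: less_imp_le)
      then have "(speed a z)\<^sup>2 \<le> 2 * \<bar>c\<bar>" using z(2) unfolding energy_def x_def by linarith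
      then have "\<bar>speed a z\<bar> \<le> r" unfolding r_def by (simp add: real_le_rsqrt)
      then show ?thesis by auto
    qed
    ultimately have "(x, speed a z) \<in> R" by (simp add: R_def)
    moreover have "T (x, speed a z) = z" by (simp add: T_def x_def speed_def)
    ultimately show "z \<in> T ` (R \<inter> (\<lambda>q. energy a b (T q)) -` {..c})"
      using z(2) by (intro image_eqI[of _ _ "(x, speed a z)"]) auto
  qed (use pos in \<open>auto simp: T_def\<close>)
  moreover have "compact (T ` (R \<inter> (\<lambda>q. energy a b (T q)) -` {..c}))"
  proof (rule compact_continuous_image)
    show "continuous_on (R \<inter> (\<lambda>q. energy a b (T q)) -` {..c}) T"
      using contT by (rule continuous_on_subset) simp
    have R: "compact R" unfolding R_def by (intro compact_Times compact_Icc)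
    have "closed (R \<inter> (\<lambda>q. energy a b (T q)) -` {..c})"
      using continuous_closed_preimage[OF cont compact_imp_closed[OF R]] by simp
    from compact_Int_closed[OF R this]
    show "compact (R \<inter> (\<lambda>q. energy a b (T q)) -` {..c})" by simp
  qed
  ultimately show ?thesis by simp
qed

lemma open_energy_sublevel:
  "open {z. fst z > 0 \<and> energy a b z < c}"
proof -
  have "continuous_on {z. fst z > 0} (energy a b)"
    by (rule continuous_on_energy) auto
  moreover have "open {z :: real \<times> real. fst z > 0}"
    by (intro open_Collect_less continuous_intros)
  ultimately have "open ({z. fst z > 0} \<inter> energy a b -` {..<c})"
    by (intro continuous_open_preimage) auto
  then show ?thesis by (simp add: Collect_conj_eq vimage_def)
qed

section \<open>Dynamics on an energy sublevel set with positive damping\<close>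

context
  fixes a b c :: real
  assumes a: "a > 0" and b: "b > 0"
    and damping_pos: "\<And>z. fst z > 0 \<Longrightarrow> energy a b z < c \<Longrightarrow> damping a b (fst z) > 0"
begin

lemma energy_deriv_nonpos:
  assumes "fst z > 0" "energy a b z < c"
  shows "energy_deriv a b z (planar_field a b z) \<le> 0"
  using damping_pos[OF assms] assms(1) by (simp add: energy_deriv_planar_field)

text \<open>
  The weight of the cross term must satisfy \<open>\<rho> (k' + f\<^sup>2 / (4 b)) < f\<close> on the sublevel set,
  with \<open>f\<close> the damping and \<open>k\<close> the restoring force; completing the square then makes the
  derivative negative definite in the speed and \<open>k\<close>.
\<close>

lemma strict_decrease:
  assumes p: "fst p > 0" "energy a b p < c"
  obtains \<rho> where "\<And>z. fst z > 0 \<Longrightarrow> energy a b z \<le> energy a b p \<Longrightarrow> z \<noteq> equilibrium_point a \<Longrightarrow>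
    energy_deriv a b z (planar_field a b z) + \<rho> * cross_deriv a z (planar_field a b z) < 0"
proof -
  define K where "K = {z. fst z > 0 \<and> energy a b z \<le> energy a b p}"
  define q where "q z = 10 * fst z + a / (fst z)\<^sup>2 - a + (damping a b (fst z))\<^sup>2 / (4 * b)" for z :: "real \<times> real"
  have K: "compact K" "p \<in> K" using compact_energy_sublevel[OF a b] p by (auto simp: K_def)
  have q1: "1 + (q z)\<^sup>2 > 0" for z by (simp add: add_pos_nonneg)
  \<comment> \<open>The minimum of this quotient over \<open>K\<close> serves as \<rho>. The
    denominator is positive and exceeds \<open>q z\<close> whatever the sign of \<open>q z\<close>,
    so \<rho> times \<open>q z\<close> stays below the damping.\<close>
  have "continuous_on K (\<lambda>z. damping a b (fst z) / (1 + (q z)\<^sup>2))"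
    unfolding q_def damping_def using b q1[unfolded q_def damping_def]
    by (intro continuous_intros) (auto simp: K_def less_imp_neq[THEN not_sym])
  then obtain m where m: "m \<in> K"
    "\<And>z. z \<in> K \<Longrightarrow> damping a b (fst m) / (1 + (q m)\<^sup>2) \<le> damping a b (fst z) / (1 + (q z)\<^sup>2)"
    using continuous_attains_inf[OF K(1)] K(2) by blast
  define \<rho> where "\<rho> = damping a b (fst m) / (1 + (q m)\<^sup>2)"
  have \<rho>: "\<rho> > 0" unfolding \<rho>_def using damping_pos[of m] m(1) p q1 by (auto simp: K_def)
  have "energy_deriv a b z (planar_field a b z) + \<rho> * cross_deriv a z (planar_field a b z) < 0"
    if z: "fst z > 0" "energy a b z \<le> energy a b p" "z \<noteq> equilibrium_point a" for z
  proof -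
    define x w k f where "x = fst z" and "w = speed a z" and "k = restoring a x" and "f = damping a b x"
    have x: "x > 0" using z by (simp add: x_def)
    have "\<rho> \<le> f / (1 + (q z)\<^sup>2)" using m(2)[of z] z by (simp add: \<rho>_def K_def f_def x_def)
    then have "\<rho> * (1 + (q z)\<^sup>2) \<le> f" using q1 by (simp add: pos_le_divide_eq)
    moreover have "q z < 1 + (q z)\<^sup>2"
      using zero_le_power2[of "q z - 1/2"] by (simp add: power2_eq_square algebra_simps)
    then have "\<rho> * q z < \<rho> * (1 + (q z)\<^sup>2)" using \<rho> by simp
    ultimately have fq: "f - \<rho> * q z > 0" by simp
    have eq: "energy_deriv a b z (planar_field a b z) + \<rho> * cross_deriv a z (planar_field a b z)
      = - x * (\<rho> * b * (k + f * w / (2 * b))\<^sup>2 + (f - \<rho> * q z) * w\<^sup>2)"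
      unfolding energy_deriv_planar_field[OF z(1)] cross_deriv_planar_field[OF z(1)] q_def
        x_def[symmetric] w_def[symmetric] f_def[symmetric] k_def[symmetric]
      using b by (simp add: field_simps power2_eq_square)
    have "\<rho> * b * (k + f * w / (2 * b))\<^sup>2 + (f - \<rho> * q z) * w\<^sup>2 > 0"
    proof (cases "w = 0")
      case True
      then have "x \<noteq> a / 5" using z(3) eq_equilibrium_point[OF a, of z] by (auto simp: w_def x_def)
      then have "k \<noteq> 0"
        using restoring_factor[OF x, of a] x by (auto simp: k_def add_nonneg_eq_0_iff)
      then show ?thesis using True \<rho> b by simp
    next
      case False
      then show ?thesis using fq \<rho> b by (intro add_nonneg_pos mult_nonneg_nonneg mult_pos_pos) auto
    qed
    then show ?thesis unfolding eq using x by (simp add: mult_pos_pos)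
  qed
  then show ?thesis using that by blast
qed

lemma solution_in_sublevel:
  assumes "fst p > 0" "energy a b p < c" and sol: "forward_solution (planar_field a b) p \<phi>" and "t \<ge> 0"
  shows "fst (\<phi> t) > 0" and "energy a b (\<phi> t) \<le> energy a b p"
proof -
  let ?U = "{z. fst z > 0 \<and> energy a b z < c}"
  have "{z \<in> ?U. energy a b z \<le> energy a b p} = {z. fst z > 0 \<and> energy a b z \<le> energy a b p}"
    using assms by auto
  then have "compact {z \<in> ?U. energy a b z \<le> energy a b p}"
    using compact_energy_sublevel[OF a b] by simp
  note inv = lyapunov_invariant[OF open_energy_sublevel _ _ _ this sol \<open>t \<ge> 0\<close>, of "energy_deriv a b"]
  have "\<phi> t \<in> ?U" by (rule inv(1)) (use assms energy_has_derivative energy_deriv_nonpos in auto)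
  then show "fst (\<phi> t) > 0" by simp
  show "energy a b (\<phi> t) \<le> energy a b p"
    by (rule inv(2)) (use assms energy_has_derivative energy_deriv_nonpos in auto)
qed

text \<open>The energy takes the part of \<open>V\<close> in \<open>lyapunov_convergence\<close>,
  and the energy plus \<rho> times \<open>cross\<close> that of \<open>W\<close>.\<close>

lemma sublevel_subset_basin:
  assumes p: "fst p > 0" "energy a b p < c"
  shows "p \<in> basin_of_attraction (planar_field a b) (equilibrium_point a)"
proof -
  let ?U = "{z. fst z > 0 \<and> energy a b z < c}"
  have "{z \<in> ?U. energy a b z \<le> energy a b p} = {z. fst z > 0 \<and> energy a b z \<le> energy a b p}"
    using p by auto
  then have comp: "compact {z \<in> ?U. energy a b z \<le> energy a b p}"
    using compact_energy_sublevel[OF a b] by simp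
  obtain \<rho> where \<rho>: "\<And>z. fst z > 0 \<Longrightarrow> energy a b z \<le> energy a b p \<Longrightarrow> z \<noteq> equilibrium_point a \<Longrightarrow>
    energy_deriv a b z (planar_field a b z) + \<rho> * cross_deriv a z (planar_field a b z) < 0"
    using strict_decrease[OF p] by blast
  have der: "(energy a b has_derivative energy_deriv a b z) (at z)"
    and der': "((\<lambda>z. energy a b z + \<rho> * cross a z) has_derivative
      (\<lambda>h. energy_deriv a b z h + \<rho> * cross_deriv a z h)) (at z)"
    and le: "energy_deriv a b z (planar_field a b z) \<le> 0" if "z \<in> ?U" for z
    using that energy_has_derivative[of z] cross_has_derivative[of z] energy_deriv_nonpos[of z]
    by (auto intro!: has_derivative_add has_derivative_mult_right)
  have "\<exists>\<phi>. forward_solution (planar_field a b) p \<phi>"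
    by (rule forward_solution_exists_lyapunov[OF open_energy_sublevel _ der le comp planar_field_lipschitz])
      (use p in auto)
  moreover have "(\<phi> \<longlongrightarrow> equilibrium_point a) at_top"
    if sol: "forward_solution (planar_field a b) p \<phi>" for \<phi>
  proof (rule lyapunov_convergence[OF open_energy_sublevel _ der der' le comp _ _ _ _ sol])
    have "continuous_on ?U (\<lambda>z. - fst z * damping a b (fst z) * (speed a z)\<^sup>2 + \<rho> * (fst z *
      ((10 * fst z + a / (fst z)\<^sup>2 - a) * (speed a z)\<^sup>2
      - damping a b (fst z) * speed a z * restoring a (fst z) - b * (restoring a (fst z))\<^sup>2)))"
      unfolding damping_def speed_def restoring_def
      by (intro continuous_intros) auto
    then show "continuous_on ?U (\<lambda>z. energy_deriv a b z (planar_field a b z) + \<rho> * cross_deriv a z (planar_field a b z))"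
      by (rule continuous_on_eq) (simp add: energy_deriv_planar_field cross_deriv_planar_field)
  qed (use p a b \<rho> energy_equilibrium energy_pos in auto)
  ultimately show ?thesis by (simp add: basin_of_attraction_def)
qed

end

section \<open>The equilibrium and its local stability\<close>

lemma planar_field_zeros:
  assumes a: "a > 0" and b: "b > 0"
  shows "{p. planar_field a b p = 0} = {equilibrium_point a}"
proof (intro equalityI subsetI)
  fix p assume "p \<in> {p. planar_field a b p = 0}"
  moreover obtain x y where p: "p = (x, y)" by (cases p)
  ultimately have eqs: "(a - x) * (1 + x\<^sup>2) - 4 * x * y = 0" "b * x * (1 + x\<^sup>2 - y) = 0"
    by (auto simp: planar_field_def zero_prod_def)
  \<comment> \<open>At \<open>x = 0\<close> the first component equals \<open>a\<close>.\<close>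
  have "x \<noteq> 0" using eqs(1) a by auto
  then have y: "y = 1 + x\<^sup>2" using eqs(2) b by simp
  have "(a - 5 * x) * (1 + x\<^sup>2) = 0" using eqs(1) by (simp add: y algebra_simps)
  moreover have "1 + x\<^sup>2 \<noteq> 0" by (simp add: add_nonneg_eq_0_iff)
  ultimately have "a = 5 * x" by simp
  then show "p \<in> {equilibrium_point a}"
    unfolding p y by (simp add: equilibrium_point_def power_divide)
qed (simp add: planar_field_def equilibrium_point_def zero_prod_def power_divide algebra_simps)

text \<open>The energy sublevel sets form a neighbourhood basis of the equilibrium. By continuity
  the damping is positive on a small one, where the preceding results apply.\<close>

lemma asymptotically_stable_if_damping_pos:
  assumes a: "a > 0" and b: "b > 0" and pos: "damping a b (a / 5) > 0"
  shows "asymptotically_stable (planar_field a b) (equilibrium_point a)"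
proof -
  let ?P = "equilibrium_point a"
  have P: "fst ?P = a / 5" "fst ?P > 0" using a by (simp_all add: equilibrium_point_def)
  have compK: "compact {z. fst z > 0 \<and> energy a b z \<le> 1}" (is "compact ?K")
    by (rule compact_energy_sublevel[OF a b])
  have cont: "continuous_on ?K (energy a b)"
    by (rule continuous_on_energy) auto
  have small: "\<exists>c>0. \<forall>z. fst z > 0 \<longrightarrow> energy a b z < c \<longrightarrow> z \<in> ball ?P e" if e: "e > 0" for e
  proof -
    obtain c where c: "c > 0" "\<And>z. z \<in> ?K \<Longrightarrow> energy a b z < c \<Longrightarrow> z \<in> ball ?P e"
      using small_sublevel[OF compK cont _ e, of ?P] energy_pos[OF a b] by auto
    \<comment> \<open>Energy below 1 already places a point in the compact set on which
      \<open>c\<close> was chosen.\<close>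
    show ?thesis by (rule exI[of _ "min c 1"]) (use c in auto)
  qed
  have nbhd: "\<exists>d>0. ball ?P d \<subseteq> {z. fst z > 0 \<and> energy a b z < c}" if "c > 0" for c
    using openE[OF open_energy_sublevel[of a b c], of ?P] P energy_equilibrium[OF a] that
    by (metis (no_types, lifting) mem_Collect_eq)
  have "isCont (\<lambda>z. damping a b (fst z)) ?P"
    unfolding damping_def using P(2) by (intro continuous_intros) auto
  then have "eventually (\<lambda>z. damping a b (fst z) > 0) (at ?P)"
    unfolding isCont_def by (rule order_tendstoD) (use pos in \<open>simp only: P(1)\<close>)
  then have "eventually (\<lambda>z. damping a b (fst z) > 0) (nhds ?P)"
    using pos by (simp only: eventually_nhds_conv_at P(1))
  then obtain e0 where e0: "e0 > 0" "\<And>z. dist z ?P < e0 \<Longrightarrow> damping a b (fst z) > 0"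
    unfolding eventually_nhds_metric by blast
  obtain c0 where c0: "c0 > 0" "\<And>z. fst z > 0 \<Longrightarrow> energy a b z < c0 \<Longrightarrow> damping a b (fst z) > 0"
    using small[OF e0(1)] e0(2) unfolding mem_ball dist_commute[of "equilibrium_point a"] by meson
  note basin = sublevel_subset_basin[OF a b c0(2)]
  show ?thesis
    unfolding asymptotically_stable_def lyapunov_stable_def
  proof (intro conjI allI impI)
    show "planar_field a b ?P = 0" using planar_field_zeros[OF a b] by auto
    show "\<exists>\<delta>>0. ball ?P \<delta> \<subseteq> basin_of_attraction (planar_field a b) ?P"
      using nbhd[OF c0(1)] basin by blast
  next
    fix e :: real assume "e > 0"
    then obtain c where c: "c > 0" "\<And>z. fst z > 0 \<Longrightarrow> energy a b z < c \<Longrightarrow> z \<in> ball ?P e"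
      using small by blast
    obtain d where d: "d > 0" "ball ?P d \<subseteq> {z. fst z > 0 \<and> energy a b z < min c c0}"
      using nbhd[of "min c c0"] c c0 by auto
    show "\<exists>\<delta>>0. \<forall>p\<in>ball ?P \<delta>. (\<exists>\<phi>. forward_solution (planar_field a b) p \<phi>) \<and>
      (\<forall>\<phi>. forward_solution (planar_field a b) p \<phi> \<longrightarrow> (\<forall>t\<ge>0. \<phi> t \<in> ball ?P e))"
    proof (intro exI[of _ d] conjI ballI allI impI d(1))
      fix p assume "p \<in> ball ?P d"
      then have p: "fst p > 0" "energy a b p < c" "energy a b p < c0" using d(2) by auto
      show "\<exists>\<phi>. forward_solution (planar_field a b) p \<phi>"
        using basin[OF _ _ p(1,3)] by (simp add: basin_of_attraction_def)
      fix \<phi> and t :: real assume sol: "forward_solution (planar_field a b) p \<phi>" and t: "t \<ge> 0"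
      note inv = solution_in_sublevel[OF a b c0(2) p(1,3) sol t]
      show "\<phi> t \<in> ball ?P e" by (rule c(2)) (use inv p in force)+
    qed
  qed
qed

text \<open>At \<open>a / 5\<close> the damping is
  \<open>b - (3 * a\<^sup>2 - 125) / (5 * a)\<close>, and the subtracted term is nonpositive exactly
  for \<open>a\<close> up to \<open>5 * sqrt (5 / 3)\<close>.\<close>

lemma region_B_damping_pos:
  assumes a: "a > 0" and b: "b > 0" and "(a, b) \<in> region_B"
  shows "damping a b (a / 5) > 0"
proof -
  have "5 * a * b > 3 * a\<^sup>2 - 125"
  proof (cases "a \<le> 5 * sqrt (5 / 3)")
    case True
    then have "a\<^sup>2 \<le> (5 * sqrt (5 / 3))\<^sup>2" using a by (intro power_mono) auto
    then have "3 * a\<^sup>2 \<le> 125" by (simp add: power_mult_distrib)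
    then show ?thesis using mult_pos_pos[OF a b] unfolding mult.assoc by linarith
  next
    case False
    then have "b > (3 * a\<^sup>2 - 125) / (5 * a)" using assms by (auto simp: region_B_def)
    then show ?thesis using a by (simp add: divide_less_eq mult_ac)
  qed
  moreover have "damping a b (a / 5) = (5 * a * b - (3 * a\<^sup>2 - 125)) / (5 * a)"
    using a by (simp add: damping_def field_simps power2_eq_square)
  ultimately show ?thesis using a by simp
qed

text \<open>With \<open>s\<close> the cube root of \<open>a\<close>, the minimum of
  \<open>a / x\<^sup>2 + 2 * x\<close> is \<open>3 * s\<close>, attained at \<open>x = s\<close>;
  the double root there explains the factorization. For \<open>a\<close> up to
  \<open>3 * sqrt 3\<close> the bound \<open>a - 3 * s = s * (s\<^sup>2 - 3)\<close> is
  nonpositive.\<close>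

lemma region_A_damping_pos:
  assumes a: "a > 0" and b: "b > 0" and "(a, b) \<in> region_A" and x: "x > 0"
  shows "damping a b x > 0"
proof -
  define s where "s = a powr (1 / 3)"
  have s: "s > 0" using a by (simp add: s_def)
  have s3: "s ^ 3 = a" using a by (simp add: s_def powr_power)
  have "a - 3 * s < b"
  proof (cases "a \<le> 3 * sqrt 3")
    case True
    have "s \<le> sqrt 3"
    proof (rule ccontr)
      assume "\<not> ?thesis"
      then have "sqrt 3 ^ 3 < s ^ 3" by (intro power_strict_mono) auto
      then show False using True unfolding s3 by (simp add: power3_eq_cube)
    qed
    then have "s\<^sup>2 \<le> 3" using s power_mono[of s "sqrt 3" 2] by simp
    then have "s * (s\<^sup>2 - 3) \<le> 0" using s by (simp add: mult_nonneg_nonpos)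
    then show ?thesis using b by (simp add: s3[symmetric] power3_eq_cube power2_eq_square algebra_simps)
  next
    case False
    then show ?thesis using assms by (auto simp: region_A_def s_def)
  qed
  moreover have "a / x\<^sup>2 + 2 * x - 3 * s = (x - s)\<^sup>2 * (2 * x + s) / x\<^sup>2"
    using x by (simp add: s3[symmetric] field_simps power2_eq_square power3_eq_cube)
  then have "a / x\<^sup>2 + 2 * x - 3 * s \<ge> 0" using x s by simp
  ultimately show ?thesis by (simp add: damping_def)
qed

theorem theorem2:
  fixes a b :: real
  assumes "a > 0" and "b > 0"
  shows "{p. planar_field a b p = 0} = {equilibrium_point a} \<and>
    ((a, b) \<in> region_B \<longrightarrow>
       asymptotically_stable (planar_field a b) (equilibrium_point a)) \<and>
    ((a, b) \<in> region_A \<longrightarrow>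
       {(x, y). x > 0} \<subseteq> basin_of_attraction (planar_field a b) (equilibrium_point a))"
proof (intro conjI impI subsetI)
  show "{p. planar_field a b p = 0} = {equilibrium_point a}"
    using planar_field_zeros[OF assms] .
  show "asymptotically_stable (planar_field a b) (equilibrium_point a)" if "(a, b) \<in> region_B"
    using asymptotically_stable_if_damping_pos region_B_damping_pos assms that by blast
  fix p :: "real \<times> real" assume A: "(a, b) \<in> region_A" and "p \<in> {(x, y). x > 0}"
  then have p: "fst p > 0" by auto
  show "p \<in> basin_of_attraction (planar_field a b) (equilibrium_point a)"
    \<comment> \<open>The damping is positive on the whole half-plane, so any level above the energy
      of \<open>p\<close> will do.\<close>
    by (rule sublevel_subset_basin[of a b "energy a b p + 1"])
      (use assms region_A_damping_pos[OF assms A] p in auto)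
qed

end
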